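(* Let $G$ be a graph and let $r\geq 1$ be an integer. Then $\mathrm{adm}_r(G)\leq 6r\bigl(\widetilde\nabla_{r-1}(G)\bigr)^3$.
   Context: All graphs are finite and simple. A linear order on $V(G)$ is an injective map $L\colon V(G)\to\mathbb{N}$; $\Pi(G)$ is the set of all such orders. The length of a path is its number of edges. For $v\in V(G)$ and $L\in\Pi(G)$, $\mathrm{adm}_r[G,L,v]$ is the maximum size $k$ of a family $\{P_1,\dots,P_k\}$ of paths of length at most $r$ in $G$, each starting at $v$ and ending at a vertex $w$ with $L(w)\le L(v)$, such that $V(P_i)\cap V(P_j)=\{v\}$ for $i\neq j$. The $r$-admissibility is $\mathrm{adm}_r(G)=\min_{L\in\Pi(G)}\max_{v\in V(G)}\mathrm{adm}_r[G,L,v]$. An $r$-subdivision of a graph $H$ is obtained from $H$ by replacing its edges by pairwise internally disjoint paths of length at most $r+1$. $H$ is a topological depth-$r$ minor of $G$ if $G$ contains a $2r$-subdivision of $H$ as a subgraph. The edge density of a graph $H$ is $\epsilon(H)=|E(H)|/|V(H)|$, and $\widetilde\nabla_r(G)$ is the maximum of $\epsilon(H)$ over all topological depth-$r$ minors $H$ of $G$.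
   Formalization: For r = 1, graphs with at least one edge and no two edges sharing a vertex are excluded: there adm_1 = 1, but the bound is 6·(1/2)^3 = 3/4, so the claim fails. The one-vertex path v is not counted in the families defining adm_r. *)

theory Defs
  imports Complex_Main
begin

type_synonym 'a graph = "'a set \<times> 'a set set"

abbreviation verts :: "'a graph \<Rightarrow> 'a set" where "verts \<equiv> fst"
abbreviation edges :: "'a graph \<Rightarrow> 'a set set" where "edges \<equiv> snd"

definition simple_graph :: "'a graph \<Rightarrow> bool" where
  "simple_graph G \<longleftrightarrow> finite (verts G) \<and> (\<forall>e\<in>edges G. e \<subseteq> verts G \<and> card e = 2)"

definition subgraph :: "'a graph \<Rightarrow> 'a graph \<Rightarrow> bool" where
  "subgraph S G \<longleftrightarrow> verts S \<subseteq> verts G \<and> edges S \<subseteq> edges G"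

definition is_path :: "'a graph \<Rightarrow> 'a list \<Rightarrow> bool" where
  "is_path G p \<longleftrightarrow> p \<noteq> [] \<and> distinct p \<and> set p \<subseteq> verts G \<and>
     (\<forall>i. Suc i < length p \<longrightarrow> {p ! i, p ! Suc i} \<in> edges G)"

definition path_edges :: "'a list \<Rightarrow> 'a set set" where
  "path_edges p = {{p ! i, p ! Suc i} | i. Suc i < length p}"

definition path_length :: "'a list \<Rightarrow> nat" where
  "path_length p = length p - 1"

definition inner_verts :: "'a list \<Rightarrow> 'a set" where
  "inner_verts p = set p - {hd p, last p}"

definition linear_orders :: "'a graph \<Rightarrow> ('a \<Rightarrow> nat) set" where
  "linear_orders G = {L. inj_on L (verts G)}"

text \<open>A family is a set of paths, each listed from \<open>v\<close>. The path consisting of \<open>v\<close> alone is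
  excluded: it meets every path of the family, itself included, exactly in \<open>v\<close>, so that as an
  indexed family it could be repeated without bound.\<close>

definition adm_family :: "'a graph \<Rightarrow> nat \<Rightarrow> ('a \<Rightarrow> nat) \<Rightarrow> 'a \<Rightarrow> 'a list set \<Rightarrow> bool" where
  "adm_family G r L v F \<longleftrightarrow>
     (\<forall>p\<in>F. is_path G p \<and> 1 \<le> path_length p \<and> path_length p \<le> r \<and>
             hd p = v \<and> L (last p) \<le> L v) \<and>
     (\<forall>p\<in>F. \<forall>q\<in>F. p \<noteq> q \<longrightarrow> set p \<inter> set q = {v})"

definition adm_at :: "'a graph \<Rightarrow> nat \<Rightarrow> ('a \<Rightarrow> nat) \<Rightarrow> 'a \<Rightarrow> nat" where
  "adm_at G r L v = Max {card F | F. adm_family G r L v F}"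

text \<open>On \<open>nat\<close>, \<open>INF\<close> of a nonempty set is its minimum and \<open>SUP\<close> of a nonempty finite set its
  maximum; the empty \<open>SUP\<close> is \<open>0\<close>, which makes the admissibility of the graph without
  vertices \<open>0\<close>.\<close>

definition adm :: "nat \<Rightarrow> 'a graph \<Rightarrow> nat" where
  "adm r G = (INF L\<in>linear_orders G. SUP v\<in>verts G. adm_at G r L v)"

text \<open>\<open>S\<close> is, up to renaming the vertices of \<open>H\<close> by \<open>\<phi>\<close>, obtained from \<open>H\<close> by replacing
  each edge \<open>e\<close> by the path \<open>P e\<close>.\<close>

definition is_subdivision :: "nat \<Rightarrow> 'b graph \<Rightarrow> 'a graph \<Rightarrow> bool" where
  "is_subdivision d H S \<longleftrightarrow>
     (\<exists>\<phi> P. inj_on \<phi> (verts H) \<and>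
        (\<forall>e\<in>edges H. is_path S (P e) \<and> path_length (P e) \<le> d + 1 \<and>
           {hd (P e), last (P e)} = \<phi> ` e \<and> inner_verts (P e) \<inter> \<phi> ` verts H = {}) \<and>
        (\<forall>e\<in>edges H. \<forall>f\<in>edges H. e \<noteq> f \<longrightarrow> inner_verts (P e) \<inter> inner_verts (P f) = {}) \<and>
        verts S = \<phi> ` verts H \<union> (\<Union>e\<in>edges H. set (P e)) \<and>
        edges S = (\<Union>e\<in>edges H. path_edges (P e)))"

definition topological_minor :: "nat \<Rightarrow> 'b graph \<Rightarrow> 'a graph \<Rightarrow> bool" where
  "topological_minor r H G \<longleftrightarrow>
     (\<exists>S. simple_graph S \<and> is_subdivision (2 * r) H S \<and> subgraph S G)"

definition edge_density :: "'a graph \<Rightarrow> real" where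
  "edge_density H = real (card (edges H)) / real (card (verts H))"

text \<open>A topological minor of \<open>G\<close> has at most as many vertices as \<open>G\<close>, so up to isomorphism it
  suffices to let \<open>H\<close> range over graphs on the vertex type of \<open>G\<close>. The graph without vertices
  has density \<open>0 / 0 = 0\<close> and does not affect the maximum.\<close>

definition top_grad :: "nat \<Rightarrow> 'a graph \<Rightarrow> real" where
  "top_grad r G =
     Max {edge_density H | H :: 'a graph. simple_graph H \<and> topological_minor r H G}"

end

theory Submission
  imports Defs
begin

text \<open>If the greedy order, in which the last vertex of the remaining set \<open>S\<close> is one with a smallest fan
  of short paths into \<open>S\<close>, does not witness the bound, then in some \<open>S\<close> every vertex has a large fan
  into \<open>S\<close>. Take a maximal system of internally disjoint paths of length at most \<open>2r - 1\<close> joining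
  distinct pairs of \<open>S\<close>; it is a topological depth-\<open>(r - 1)\<close> minor on \<open>S\<close>, hence sparse and degenerate,
  so its set \<open>M\<close> of inner vertices is small and some large \<open>R \<subseteq> S\<close> is independent in it. Cut the fans
  of the vertices in \<open>R\<close> at their first vertex in \<open>S \<union> M\<close>. By maximality, fans of different vertices
  of \<open>R\<close> do not meet before their ends, so the cut fans form a topological depth-\<open>(r - 1)\<close> minor on
  \<open>S \<union> M\<close>, which is too dense. The final arithmetic needs density at least
  \<open>2 / 3\<close>, which holds unless the edges of the graph form a matching; then all fans have size at most one.\<close>

section \<open>Paths as lists\<close>

lemma is_path_iff:
  "is_path G p \<longleftrightarrow> p \<noteq> [] \<and> distinct p \<and> set p \<subseteq> verts G \<and>
     successively (\<lambda>x y. {x, y} \<in> edges G) p"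
  unfolding is_path_def successively_conv_nth by auto

lemma inner_verts_Cons_snoc:
  assumes "distinct (a # xs @ [b])"
  shows "inner_verts (a # xs @ [b]) = set xs"
  using assms unfolding inner_verts_def by auto

lemma finite_paths:
  assumes "simple_graph G"
  shows "finite {p. is_path G p}"
proof -
  have "{p. is_path G p} \<subseteq> {p. set p \<subseteq> verts G \<and> distinct p}"
    by (auto simp: is_path_def)
  then show ?thesis
    using assms finite_subset finite_subset_distinct[of "verts G"]
    unfolding simple_graph_def by blast
qed

lemma card_inner_verts_le:
  assumes "distinct p" "hd p \<noteq> last p" "path_length p \<le> Suc n"
  shows "card (inner_verts p) \<le> n"
proof (cases "p = []")
  case True
  then show ?thesis by (simp add: inner_verts_def)
next
  case False
  have "card (inner_verts p) = card (set p) - card {hd p, last p}"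
    unfolding inner_verts_def using False by (intro card_Diff_subset) auto
  then show ?thesis
    using assms by (simp add: distinct_card path_length_def)
qed

text \<open>The cut is made at the first vertex after the start that lies in \<open>B\<close>. Only
  the tail is searched, since the start may itself lie in \<open>B\<close>.\<close>

lemma is_path_truncate:
  assumes p: "is_path G p" and len: "1 \<le> path_length p" and B: "last p \<in> B"
  shows "\<exists>q. is_path G q \<and> hd q = hd p \<and> 1 \<le> path_length q \<and> path_length q \<le> path_length p \<and>
     set q \<subseteq> set p \<and> last q \<in> B \<and> inner_verts q \<inter> B = {} \<and> last q \<noteq> hd q"
proof -
  obtain v ys where pv: "p = v # ys"
    using p unfolding is_path_def by (cases p) auto
  moreover have ys: "ys \<noteq> []"
    using len unfolding path_length_def pv by auto
  ultimately have "\<exists>x\<in>set ys. x \<in> B"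
    using B by auto
  then obtain as b bs where ys_eq: "ys = as @ b # bs" and b: "b \<in> B" and as: "\<forall>a\<in>set as. a \<notin> B"
    using split_list_first_prop[of ys "\<lambda>x. x \<in> B"] by blast
  let ?q = "v # as @ [b]"
  have d: "distinct ?q"
    using p unfolding is_path_def pv ys_eq by auto
  have "p = ?q @ bs"
    by (simp add: pv ys_eq)
  then have "successively (\<lambda>x y. {x, y} \<in> edges G) ?q" "set ?q \<subseteq> verts G"
    using p successively_append_iff[of _ ?q bs] unfolding is_path_iff by (metis, simp)
  with d have "is_path G ?q"
    unfolding is_path_iff by blast
  moreover have "inner_verts ?q \<inter> B = {}"
    using inner_verts_Cons_snoc[OF d] as by auto
  ultimately show ?thesis
    using b d by (intro exI[of _ ?q]) (auto simp: pv ys_eq path_length_def)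
qed

text \<open>Follow \<open>p\<close> to its first inner vertex that is also inner in
  \<open>q\<close>, then follow \<open>q\<close> backwards to its start; choosing the first such
  vertex keeps the result free of repetitions. Both paths lose at least their last edge, hence the
  \<open>+ 2\<close>.\<close>

lemma is_path_join:
  assumes p: "is_path G p" and q: "is_path G q"
    and xp: "x \<in> inner_verts p" and xq: "x \<in> inner_verts q"
    and u: "hd p \<notin> inner_verts q" and v: "hd q \<notin> inner_verts p" and uv: "hd p \<noteq> hd q"
  shows "\<exists>w. is_path G w \<and> hd w = hd p \<and> last w = hd q \<and>
     path_length w + 2 \<le> path_length p + path_length q \<and>
     inner_verts w \<subseteq> inner_verts p \<union> inner_verts q"
proof -
  have decomp: "\<exists>a as b. p = a # as @ [b]" if xin: "x \<in> inner_verts p" for p :: "'a list" and x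
  proof -
    have "p \<noteq> []"
      using xin unfolding inner_verts_def by auto
    then obtain a ys where p: "p = a # ys"
      by (cases p) auto
    then have "ys \<noteq> []"
      using xin unfolding inner_verts_def by auto
    with p show ?thesis
      by (metis rev_exhaust)
  qed
  obtain a as b where pe: "p = a # as @ [b]" using decomp[OF xp] by blast
  obtain c cs e where qe: "q = c # cs @ [e]" using decomp[OF xq] by blast
  have dp: "distinct p" and dq: "distinct q"
    using p q by (auto simp: is_path_def)
  have ip: "inner_verts p = set as" and iq: "inner_verts q = set cs"
    using inner_verts_Cons_snoc[of a as b] inner_verts_Cons_snoc[of c cs e] dp dq by (simp_all add: pe qe)
  have "\<exists>y\<in>set as. y \<in> set cs"
    using xp xq ip iq by auto
  then obtain a1 y a2 where as: "as = a1 @ y # a2" and y: "y \<in> set cs" and a1: "\<forall>z\<in>set a1. z \<notin> set cs"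
    using split_list_first_prop[of as "\<lambda>x. x \<in> set cs"] by blast
  obtain c1 c2 where cs: "cs = c1 @ y # c2"
    using y split_list by metis
  let ?w = "a # (a1 @ y # rev c1) @ [c]"
  have dw: "distinct ?w"
    using dp dq u v uv a1 unfolding ip iq unfolding pe qe as cs by auto
  let ?R = "\<lambda>x y. {x, y} \<in> edges G"
  have "successively ?R ((a # a1 @ [y]) @ (a2 @ [b]))"
    using p by (simp add: is_path_iff pe as)
  then have "successively ?R (a # a1 @ [y])"
    unfolding successively_append_iff[of ?R "a # a1 @ [y]"] by blast
  moreover have "successively ?R ((c # c1 @ [y]) @ (c2 @ [e]))"
    using q by (simp add: is_path_iff qe cs)
  then have "successively ?R (c # c1 @ [y])"
    unfolding successively_append_iff[of ?R "c # c1 @ [y]"] by blast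
  then have "successively (\<lambda>x y. ?R y x) (rev (c # c1 @ [y]))"
    unfolding successively_rev .
  then have "successively ?R (y # rev c1 @ [c])"
    by (simp add: insert_commute)
  ultimately have "successively ?R ?w"
    using successively_append_iff[of ?R "a # a1" "[y]"]
      successively_append_iff[of ?R "a # a1" "y # rev c1 @ [c]"] by simp
  moreover have "set ?w \<subseteq> verts G"
    using p q unfolding is_path_def pe qe as cs by auto
  ultimately have "is_path G ?w"
    using dw unfolding is_path_iff by blast
  moreover have "inner_verts ?w \<subseteq> inner_verts p \<union> inner_verts q"
    unfolding inner_verts_Cons_snoc[OF dw] ip iq by (auto simp: as cs)
  ultimately show ?thesis
    by (intro exI[of _ ?w]) (auto simp: pe qe as cs path_length_def)
qed

section \<open>Path systems and topological minors\<close>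

text \<open>Encodes a subdivision by its set of paths alone: the subdivided graph has vertex set
  \<open>B\<close> and the endpoint pairs as edges, with no renaming of vertices. Distinct paths
  have distinct endpoint pairs, so each path stands for exactly one edge.\<close>

definition path_system :: "'a graph \<Rightarrow> nat \<Rightarrow> 'a set \<Rightarrow> 'a list set \<Rightarrow> bool" where
  "path_system G d B Q \<longleftrightarrow>
     (\<forall>p\<in>Q. is_path G p \<and> hd p \<in> B \<and> last p \<in> B \<and> hd p \<noteq> last p \<and>
        path_length p \<le> d + 1 \<and> inner_verts p \<inter> B = {}) \<and>
     (\<forall>p\<in>Q. \<forall>q\<in>Q. p \<noteq> q \<longrightarrow>
        {hd p, last p} \<noteq> {hd q, last q} \<and> inner_verts p \<inter> inner_verts q = {})"

lemma path_edges_subset: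
  "is_path G p \<Longrightarrow> path_edges p \<subseteq> edges G"
  unfolding is_path_def path_edges_def by auto

lemma path_edges_subset_set:
  assumes "e \<in> path_edges p"
  shows "e \<subseteq> set p"
  using assms unfolding path_edges_def by auto

text \<open>A density is a quotient of two bounded integers, since the branch vertices of a minor
  embed into \<open>verts G\<close>. Finiteness makes the \<open>Max\<close> in
  \<open>top_grad\<close> an upper bound.\<close>

lemma finite_densities:
  assumes G: "simple_graph G"
  shows "finite {edge_density H | H :: 'a graph. simple_graph H \<and> topological_minor r H G}"
proof -
  let ?n = "card (verts G)"
  have fG: "finite (verts G)"
    using G by (simp add: simple_graph_def)
  have "{edge_density H | H :: 'a graph. simple_graph H \<and> topological_minor r H G}
      \<subseteq> (\<lambda>(a, b). real a / real b) ` ({..2 ^ ?n} \<times> {..?n})"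
  proof clarify
    fix VH :: "'a set" and EH
    assume H: "simple_graph (VH, EH)" and tm: "topological_minor r (VH, EH) G"
    obtain S \<phi> where "inj_on \<phi> VH" "\<phi> ` VH \<subseteq> verts S" "verts S \<subseteq> verts G"
      using tm unfolding topological_minor_def is_subdivision_def subgraph_def by auto
    then have c: "card VH \<le> ?n"
      using card_inj_on_le[of \<phi> VH "verts G"] fG by blast
    have "EH \<subseteq> Pow VH" "finite VH"
      using H by (auto simp: simple_graph_def)
    then have "card EH \<le> 2 ^ card VH"
      using card_mono[of "Pow VH" EH] by (simp add: card_Pow)
    also have "\<dots> \<le> 2 ^ ?n"
      using c by (simp add: power_increasing)
    finally show "edge_density (VH, EH) \<in> (\<lambda>(a, b). real a / real b) ` ({..2 ^ ?n} \<times> {..?n})"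
      using c by (intro image_eqI[of _ _ "(card EH, card VH)"]) (auto simp: edge_density_def)
  qed
  then show ?thesis
    using finite_subset by blast
qed

lemma edge_density_le_top_grad:
  fixes G H :: "'a graph"
  assumes "simple_graph G" "simple_graph H" "topological_minor r H G"
  shows "edge_density H \<le> top_grad r G"
  unfolding top_grad_def using assms(2,3) by (intro Max_ge finite_densities[OF assms(1)]) blast

lemma top_grad_nonneg:
  assumes "simple_graph G"
  shows "0 \<le> top_grad r G"
proof -
  \<comment> \<open>The empty graph is a minor of every graph, and its density \<open>0 / 0\<close>
    is \<open>0\<close>.\<close>
  have "is_subdivision (2 * r) ({}, {}) ({}, {})"
    by (simp add: is_subdivision_def)
  moreover have "simple_graph ({}, {})" "subgraph ({}, {}) G"
    by (simp_all add: simple_graph_def subgraph_def)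
  ultimately have "topological_minor r ({} :: 'a set, {}) G"
    unfolding topological_minor_def by blast
  then have "edge_density ({} :: 'a set, {}) \<le> top_grad r G"
    using assms by (intro edge_density_le_top_grad) (auto simp: simple_graph_def)
  then show ?thesis
    by (simp add: edge_density_def)
qed

text \<open>The encoded graph is a topological minor with the identity as branch map; inverting the
  injective map from paths to endpoint pairs recovers the path of each edge. Its density is
  \<open>card Q / card B\<close>.\<close>

lemma card_path_system_le:
  assumes G: "simple_graph G" and B: "B \<subseteq> verts G" and Q: "path_system G (2 * s) B Q"
  shows "real (card Q) \<le> top_grad s G * real (card B)"
proof (cases "B = {}")
  case True
  then have "Q = {}"
    using Q unfolding path_system_def by auto
  then show ?thesis
    using True by simp
next
  case False
  have fB: "finite B"
    using G B finite_subset unfolding simple_graph_def by blast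
  let ?e = "\<lambda>p :: 'a list. {hd p, last p}"
  have inj: "inj_on ?e Q"
    using Q unfolding path_system_def inj_on_def by blast
  define P where "P = the_inv_into Q ?e"
  have P: "P (?e p) = p" if "p \<in> Q" for p
    unfolding P_def using the_inv_into_f_f[OF inj that] .
  define H where "H = (B, ?e ` Q)"
  define S where "S = (B \<union> (\<Union>p\<in>Q. set p), \<Union>p\<in>Q. path_edges p)"
  have Qd: "is_path G p" "hd p \<in> B" "last p \<in> B" "hd p \<noteq> last p" "path_length p \<le> 2 * s + 1"
      "inner_verts p \<inter> B = {}" if "p \<in> Q" for p
    using Q that unfolding path_system_def by auto
  have H: "simple_graph H"
    using fB Qd unfolding simple_graph_def H_def by auto
  have "set p \<subseteq> verts G" "path_edges p \<subseteq> edges G" if "p \<in> Q" for p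
    using Qd(1)[OF that] path_edges_subset[of G p] unfolding is_path_def by blast+
  then have SG: "subgraph S G"
    using B unfolding subgraph_def S_def by (simp add: UN_least)
  moreover have S: "simple_graph S"
  proof -
    have "finite (verts S)"
      using SG G finite_subset unfolding simple_graph_def subgraph_def by blast
    moreover have "card e = 2" if "e \<in> edges S" for e
      using SG G that unfolding simple_graph_def subgraph_def by blast
    moreover have "e \<subseteq> verts S" if e: "e \<in> edges S" for e
    proof -
      obtain p where "p \<in> Q" "e \<in> path_edges p"
        using e unfolding S_def by auto
      then show ?thesis
        using path_edges_subset_set[of e p] unfolding S_def by auto
    qed
    ultimately show ?thesis
      unfolding simple_graph_def by blast
  qed
  moreover have "is_subdivision (2 * s) H S"
  proof -
    have "is_path S p" if p: "p \<in> Q" for p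
    proof -
      have "set p \<subseteq> verts S" "path_edges p \<subseteq> edges S"
        using p unfolding S_def by auto
      then show ?thesis
        using Qd(1)[OF p] unfolding is_path_def path_edges_def by blast
    qed
    moreover have "inner_verts (P e) \<inter> inner_verts (P f) = {}"
      if ef: "e \<in> ?e ` Q" "f \<in> ?e ` Q" "e \<noteq> f" for e f
    proof -
      obtain p q where pq: "p \<in> Q" "q \<in> Q" "e = ?e p" "f = ?e q"
        using ef(1,2) by blast
      then have "p \<noteq> q"
        using ef(3) by blast
      with pq have "inner_verts p \<inter> inner_verts q = {}"
        using Q unfolding path_system_def by blast
      then show ?thesis
        using P pq by simp
    qed
    ultimately show ?thesis
      unfolding is_subdivision_def using P Qd
      by (intro exI[of _ "\<lambda>x. x"] exI[of _ P]) (simp add: H_def S_def)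
  qed
  ultimately have "edge_density H \<le> top_grad s G"
    using edge_density_le_top_grad[OF G H] unfolding topological_minor_def by blast
  moreover have "edge_density H = real (card Q) / real (card B)"
    unfolding edge_density_def H_def using card_image[OF inj] by simp
  moreover have "card B > 0"
    using False fB by (simp add: card_gt_0_iff)
  ultimately show ?thesis
    by (simp add: field_simps)
qed

lemma path_system_restrict:
  assumes "path_system G d B Q" "W \<subseteq> B"
  shows "path_system G d W {p \<in> Q. hd p \<in> W \<and> last p \<in> W}"
  using assms unfolding path_system_def by blast

lemma finite_path_system:
  assumes "simple_graph G" "path_system G d B Q"
  shows "finite Q"
  using finite_subset[OF _ finite_paths[OF assms(1)], of Q] assms(2)
  unfolding path_system_def by blast

section \<open>Independent sets\<close>

text \<open>Greedy choice: take \<open>w\<close> with at most \<open>k\<close> neighbours in the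
  current set and delete it together with them. Each chosen vertex costs at most
  \<open>k + 1\<close> vertices.\<close>

lemma independent_set_of_degenerate:
  fixes N :: "'a \<Rightarrow> 'a set"
  assumes "finite V"
    and sym: "\<And>u v. u \<in> N v \<Longrightarrow> v \<in> N u"
    and deg: "\<And>W. W \<subseteq> V \<Longrightarrow> W \<noteq> {} \<Longrightarrow> \<exists>w\<in>W. card (N w \<inter> W) \<le> k"
  shows "\<exists>R\<subseteq>V. card V \<le> (k + 1) * card R \<and> (\<forall>u\<in>R. \<forall>v\<in>R. u \<noteq> v \<longrightarrow> u \<notin> N v)"
  using assms(1,3)
proof (induction V rule: finite_psubset_induct)
  case (psubset V)
  show ?case
  proof (cases "V = {}")
    case True
    then show ?thesis by auto
  next
    case False
    then obtain w where w: "w \<in> V" "card (N w \<inter> V) \<le> k"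
      using psubset.prems by blast
    let ?D = "insert w (N w \<inter> V)"
    let ?V' = "V - ?D"
    obtain R where R: "R \<subseteq> ?V'" "card ?V' \<le> (k + 1) * card R"
        "\<forall>u\<in>R. \<forall>v\<in>R. u \<noteq> v \<longrightarrow> u \<notin> N v"
      using psubset.IH[of ?V'] psubset.prems w(1) by blast
    have "?V' \<union> ?D = V"
      using w(1) by blast
    then have "card V \<le> card ?V' + card ?D"
      using card_Un_le[of ?V' ?D] by simp
    moreover have "card ?D \<le> k + 1"
      using w(2) psubset.hyps by (simp add: card_insert_if)
    moreover have "card (insert w R) = card R + 1"
      using R(1) psubset.hyps by (subst card_insert_disjoint) (auto intro: finite_subset)
    ultimately have "card V \<le> (k + 1) * card (insert w R)"
      using R(2) by simp
    moreover have "\<forall>u\<in>insert w R. \<forall>v\<in>insert w R. u \<noteq> v \<longrightarrow> u \<notin> N v"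
      using R(1,3) sym by blast
    ultimately show ?thesis
      using R(1) w(1) by (intro exI[of _ "insert w R"]) blast
  qed
qed

text \<open>The paths with both ends in \<open>W\<close> form a system on \<open>W\<close>, so the
  average degree on \<open>W\<close> is at most \<open>2 * top_grad s G\<close>. Degrees are
  integers, so a vertex of at most average degree meets the floor.\<close>

lemma path_system_degenerate:
  assumes G: "simple_graph G" and S: "S \<subseteq> verts G" and Q: "path_system G (2 * s) S Q"
    and W: "W \<subseteq> S" "W \<noteq> {}"
  shows "\<exists>w\<in>W. card ({u. \<exists>p\<in>Q. {hd p, last p} = {u, w}} \<inter> W) \<le> nat \<lfloor>2 * top_grad s G\<rfloor>"
proof (rule ccontr)
  assume neg: "\<not> ?thesis"
  let ?d = "top_grad s G"
  let ?k = "nat \<lfloor>2 * ?d\<rfloor>"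
  define QW where "QW = {p \<in> Q. hd p \<in> W \<and> last p \<in> W}"
  define h where "h w = card {p \<in> QW. hd p = w}" for w
  define l where "l w = card {p \<in> QW. last p = w}" for w
  have fQ: "finite QW"
    using finite_path_system[OF G Q] by (simp add: QW_def)
  have WV: "W \<subseteq> verts G"
    using S W(1) by blast
  then have fW: "finite W"
    using G finite_subset unfolding simple_graph_def by blast
  have QW: "real (card QW) \<le> ?d * card W"
    using card_path_system_le[OF G WV path_system_restrict[OF Q W(1)]] unfolding QW_def .
  have le: "?k + 1 \<le> h w + l w" if w: "w \<in> W" for w
  proof -
    \<comment> \<open>Paths are listed in one direction, so neighbours of \<open>w\<close> are
      collected from the paths that start at \<open>w\<close> and those that end there.\<close>
    let ?A = "last ` {p \<in> QW. hd p = w} \<union> hd ` {p \<in> QW. last p = w}"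
    have "\<not> card ({u. \<exists>p\<in>Q. {hd p, last p} = {u, w}} \<inter> W) \<le> ?k"
      using neg w by blast
    then have "?k + 1 \<le> card ({u. \<exists>p\<in>Q. {hd p, last p} = {u, w}} \<inter> W)"
      by linarith
    also have "\<dots> \<le> card ?A"
    proof (rule card_mono)
      show "{u. \<exists>p\<in>Q. {hd p, last p} = {u, w}} \<inter> W \<subseteq> ?A"
      proof
        fix u assume "u \<in> {u. \<exists>p\<in>Q. {hd p, last p} = {u, w}} \<inter> W"
        then obtain p where p: "p \<in> Q" "{hd p, last p} = {u, w}" "u \<in> W"
          by blast
        then have "hd p = u \<and> last p = w \<or> hd p = w \<and> last p = u"
          by (simp add: doubleton_eq_iff)
        then show "u \<in> ?A"
          using p(1,3) w unfolding QW_def by blast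
      qed
    qed (use fQ in simp)
    also have "\<dots> \<le> card (last ` {p \<in> QW. hd p = w}) + card (hd ` {p \<in> QW. last p = w})"
      by (rule card_Un_le)
    also have "\<dots> \<le> h w + l w"
      unfolding h_def l_def using fQ by (intro add_mono card_image_le) simp_all
    finally show ?thesis .
  qed
  \<comment> \<open>Used with \<open>hd\<close> and \<open>last\<close>: every path is counted once
    at each of its ends.\<close>
  have fib: "(\<Sum>w\<in>W. card {p \<in> QW. g p = w}) = card QW" if "g ` QW \<subseteq> W" for g
    unfolding card_eq_sum by (rule sum.group[OF fQ fW that])
  have "card W * (?k + 1) = (\<Sum>w\<in>W. ?k + 1)"
    by simp
  also have "\<dots> \<le> (\<Sum>w\<in>W. h w + l w)"
    using le by (rule sum_mono)
  also have "\<dots> = card QW + card QW"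
  proof -
    have "hd ` QW \<subseteq> W" "last ` QW \<subseteq> W"
      unfolding QW_def by blast+
    then show ?thesis
      by (simp only: sum.distrib h_def l_def fib)
  qed
  finally have "real (card W * (?k + 1)) \<le> real (card QW + card QW)"
    by (rule of_nat_mono)
  then have "real (card W) * (real ?k + 1) \<le> real (card W) * (2 * ?d)"
    using QW by (simp add: algebra_simps)
  moreover have "0 < real (card W)"
    using W(2) fW by (simp add: card_gt_0_iff)
  ultimately have "real ?k + 1 \<le> 2 * ?d"
    using mult_le_cancel_left_pos by blast
  then show False
    by linarith
qed

section \<open>Fans\<close>

text \<open>A variant of \<open>adm_family\<close> in which a target set \<open>S\<close> replaces
  the vertices not above \<open>v\<close>, so that fans can be discussed before an order is
  chosen.\<close>

definition fan :: "'a graph \<Rightarrow> nat \<Rightarrow> 'a set \<Rightarrow> 'a \<Rightarrow> 'a list set \<Rightarrow> bool" where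
  "fan G r S v F \<longleftrightarrow>
     (\<forall>p\<in>F. is_path G p \<and> 1 \<le> path_length p \<and> path_length p \<le> r \<and> hd p = v \<and> last p \<in> S) \<and>
     (\<forall>p\<in>F. \<forall>q\<in>F. p \<noteq> q \<longrightarrow> set p \<inter> set q = {v})"

lemma finite_fan:
  assumes "simple_graph G" "fan G r S v F"
  shows "finite F"
  using finite_subset[OF _ finite_paths[OF assms(1)], of F] assms(2) unfolding fan_def by blast

section \<open>The greedy order and its admissibility\<close>

text \<open>A vertex with only small fans into the whole set is placed last, and the rest is ordered
  by induction; this leaves the predecessor sets of the other vertices unchanged.\<close>

lemma order_of_small_fans:
  assumes "finite S"
    and "\<And>W. W \<subseteq> S \<Longrightarrow> W \<noteq> {} \<Longrightarrow> \<exists>v\<in>W. \<forall>F. fan G r W v F \<longrightarrow> card F \<le> K"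
  shows "\<exists>L :: 'a \<Rightarrow> nat. inj_on L S \<and> L ` S \<subseteq> {..<card S} \<and>
     (\<forall>v\<in>S. \<forall>F. fan G r {w \<in> S. L w \<le> L v} v F \<longrightarrow> card F \<le> K)"
  using assms
proof (induction S rule: finite_psubset_induct)
  case (psubset S)
  show ?case
  proof (cases "S = {}")
    case True
    then show ?thesis by auto
  next
    case False
    then obtain v where v: "v \<in> S" "\<forall>F. fan G r S v F \<longrightarrow> card F \<le> K"
      using psubset.prems[OF subset_refl] by blast
    let ?T = "S - {v}"
    have T: "?T \<subset> S"
      using v(1) by blast
    have "\<exists>v\<in>W. \<forall>F. fan G r W v F \<longrightarrow> card F \<le> K" if "W \<subseteq> ?T" "W \<noteq> {}" for W
      using psubset.prems[of W] that by blast
    from psubset.IH[OF T this]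
    obtain L :: "'a \<Rightarrow> nat" where L: "inj_on L ?T" "L ` ?T \<subseteq> {..<card ?T}"
        "\<forall>u\<in>?T. \<forall>F. fan G r {w \<in> ?T. L w \<le> L u} u F \<longrightarrow> card F \<le> K"
      by blast
    have c: "card S = Suc (card ?T)"
      using card_Suc_Diff1[OF psubset.hyps(1) v(1)] by simp
    \<comment> \<open>The bound on the image of \<open>L\<close> makes \<open>card ?T\<close> larger
      than all values in use.\<close>
    let ?L = "L(v := card ?T)"
    have lt: "L u < card ?T" if "u \<in> S" "u \<noteq> v" for u
      using L(2) that by auto
    have inj: "inj_on ?L S"
    proof (rule inj_onI)
      fix x y assume "x \<in> S" "y \<in> S" "?L x = ?L y"
      then show "x = y"
        using L(1) lt[of x] lt[of y] by (auto simp: inj_on_def split: if_splits)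
    qed
    have other: "{w \<in> S. ?L w \<le> ?L u} = {w \<in> ?T. L w \<le> L u}" if "u \<in> S" "u \<noteq> v" for u
      using lt[OF that] that by auto
    have top: "{w \<in> S. ?L w \<le> ?L v} = S"
      using lt by (auto intro: less_imp_le)
    have "\<forall>F. fan G r {w \<in> S. ?L w \<le> ?L u} u F \<longrightarrow> card F \<le> K" if u: "u \<in> S" for u
    proof (cases "u = v")
      case True
      then show ?thesis
        using v(2) top by simp
    next
      case False
      then have "u \<in> ?T"
        using u by blast
      then show ?thesis
        using L(3) unfolding other[OF u False] by blast
    qed
    moreover have "?L ` S \<subseteq> {..<card S}"
      using lt unfolding c by (auto intro: less_SucI)
    ultimately show ?thesis
      using inj by blast
  qed
qed

lemma adm_le:
  assumes G: "simple_graph G"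
    and small: "\<And>S. S \<subseteq> verts G \<Longrightarrow> S \<noteq> {} \<Longrightarrow> \<exists>v\<in>S. \<forall>F. fan G r S v F \<longrightarrow> card F \<le> K"
  shows "adm r G \<le> K"
proof -
  have fV: "finite (verts G)"
    using G by (simp add: simple_graph_def)
  obtain L :: "'a \<Rightarrow> nat" where L: "inj_on L (verts G)"
      "\<forall>v\<in>verts G. \<forall>F. fan G r {w \<in> verts G. L w \<le> L v} v F \<longrightarrow> card F \<le> K"
    using order_of_small_fans[OF fV small] by blast
  have at: "adm_at G r L v \<le> K" if v: "v \<in> verts G" for v
  proof -
    have "card F \<le> K" if F: "adm_family G r L v F" for F
    proof -
      have "last p \<in> verts G" if "is_path G p" for p
        using that last_in_set[of p] unfolding is_path_def by auto
      then have "fan G r {w \<in> verts G. L w \<le> L v} v F"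
        using F unfolding adm_family_def fan_def by simp
      then show ?thesis
        using L(2) v by blast
    qed
    then have le: "{card F | F. adm_family G r L v F} \<subseteq> {..K}"
      by blast
    \<comment> \<open>The empty family makes the set of sizes nonempty, so its \<open>Max\<close> is
      one of its elements.\<close>
    have "adm_family G r L v {}"
      by (simp add: adm_family_def)
    then have "{card F | F. adm_family G r L v F} \<noteq> {}"
      by blast
    with le show ?thesis
      unfolding adm_at_def using Max_in[OF finite_subset[OF le finite_atMost]] by blast
  qed
  have "adm r G \<le> (SUP v\<in>verts G. adm_at G r L v)"
    unfolding adm_def using L(1) by (intro cINF_lower) (simp_all add: linear_orders_def)
  also have "\<dots> \<le> K"
  proof (cases "verts G = {}")
    case False
    then show ?thesis
      using at by (rule cSUP_least)
  qed simp
  finally show ?thesis .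
qed

section \<open>Large fans force a dense minor\<close>

text \<open>The first factor \<open>d\<close> bounds the density of the minor on
  \<open>S \<union> M\<close>, the floor plus one bounds the ratio of \<open>card S\<close> to
  \<open>card R\<close>, and the last factor bounds the ratio of \<open>card S + card M\<close> to
  \<open>card S\<close>.\<close>

lemma card_le_of_fans:
  assumes G: "simple_graph G" and r: "1 \<le> r" and S: "S \<subseteq> verts G" "S \<noteq> {}"
    and fans: "\<And>v. v \<in> S \<Longrightarrow> \<exists>F. fan G r S v F \<and> l \<le> card F"
  defines "d \<equiv> top_grad (r - 1) G"
  shows "real l \<le> d * (real (nat \<lfloor>2 * d\<rfloor>) + 1) * (1 + 2 * real (r - 1) * d)"
proof -
  \<comment> \<open>Depth \<open>r - 1\<close> allows paths of length at most \<open>?s + 1\<close>,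
    which is \<open>2 * r - 1\<close>.\<close>
  let ?s = "2 * (r - 1)"
  let ?k = "nat \<lfloor>2 * d\<rfloor>"
  have fS: "finite S"
    using G S finite_subset unfolding simple_graph_def by blast
  have d0: "0 \<le> d"
    unfolding d_def using top_grad_nonneg[OF G] .
  let ?PS = "{Q. path_system G ?s S Q}"
  have "?PS \<subseteq> Pow {p. is_path G p}"
    unfolding path_system_def by blast
  then have finPS: "finite (card ` ?PS)"
    using finite_paths[OF G] finite_subset by blast
  have "{} \<in> ?PS"
    by (simp add: path_system_def)
  then have "Max (card ` ?PS) \<in> card ` ?PS"
    using finPS by (intro Max_in) blast+
  then obtain Q where Q: "path_system G ?s S Q" and QMax: "card Q = Max (card ` ?PS)"
    by auto
  have Qmax: "card Q' \<le> card Q" if "path_system G ?s S Q'" for Q'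
    unfolding QMax using that finPS by (intro Max_ge) blast+
  have fQ: "finite Q"
    using finite_path_system[OF G Q] .
  define M where "M = (\<Union>p\<in>Q. inner_verts p)"
  have MV: "M \<subseteq> verts G"
    using Q unfolding M_def path_system_def is_path_def inner_verts_def by blast
  have cardQ: "real (card Q) \<le> d * card S"
    unfolding d_def using card_path_system_le[OF G S(1) Q] .
  have "card M \<le> (\<Sum>p\<in>Q. card (inner_verts p))"
    unfolding M_def by (rule card_UN_le[OF fQ])
  also have "\<dots> \<le> (\<Sum>p\<in>Q. ?s)"
    using Q by (intro sum_mono card_inner_verts_le) (auto simp: path_system_def is_path_def)
  finally have "real (card M) \<le> real (card Q) * real ?s"
    by (simp flip: of_nat_mult)
  also have "\<dots> \<le> d * card S * real ?s"
    using cardQ by (intro mult_right_mono) auto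
  finally have cardM: "real (card M) \<le> d * card S * real ?s" .
  let ?B = "S \<union> M"
  \<comment> \<open>Such a path could be added to \<open>Q\<close> unless its pair of ends is
    already joined.\<close>
  have max: "\<exists>q\<in>Q. {hd q, last q} = {hd p, last p}"
    if p: "is_path G p" "hd p \<in> S" "last p \<in> S" "hd p \<noteq> last p" "path_length p \<le> ?s + 1"
      "inner_verts p \<inter> ?B = {}" for p
  proof (rule ccontr)
    assume no: "\<not> ?thesis"
    then have "p \<notin> Q" by blast
    moreover have "inner_verts p \<inter> inner_verts q = {}" if "q \<in> Q" for q
      using p(6) that unfolding M_def by blast
    then have "path_system G ?s S (insert p Q)"
      using Q p no unfolding path_system_def by (simp add: Int_commute Int_Un_distrib) metis
    ultimately show False
      using Qmax[of "insert p Q"] fQ by simp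
  qed
  \<comment> \<open>Vertices count as adjacent when a path of \<open>Q\<close> joins them;
    \<open>R\<close> is independent in this sense.\<close>
  let ?N = "\<lambda>w. {u. \<exists>p\<in>Q. {hd p, last p} = {u, w}}"
  have "\<exists>w\<in>W. card (?N w \<inter> W) \<le> ?k" if "W \<subseteq> S" "W \<noteq> {}" for W
    using path_system_degenerate[OF G S(1) Q that] unfolding d_def .
  then obtain R where R: "R \<subseteq> S" "card S \<le> (?k + 1) * card R"
      "\<forall>u\<in>R. \<forall>v\<in>R. u \<noteq> v \<longrightarrow> u \<notin> ?N v"
    using independent_set_of_degenerate[OF fS, of ?N ?k] by (auto simp: insert_commute)
  have noR: False if "is_path G p" "hd p \<in> R" "last p \<in> R" "hd p \<noteq> last p" "path_length p \<le> ?s + 1"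
      "inner_verts p \<inter> ?B = {}" for p
    using max[of p] R(1,3) that by blast
  have "\<forall>v\<in>S. \<exists>F. fan G r S v F \<and> l \<le> card F"
    using fans by blast
  then obtain F where F: "\<And>v. v \<in> S \<Longrightarrow> fan G r S v (F v)" "\<And>v. v \<in> S \<Longrightarrow> l \<le> card (F v)"
    by metis
  \<comment> \<open>Truncation becomes a function \<open>t\<close>, whose values may end in
    \<open>M\<close> instead of \<open>S\<close>.\<close>
  have "\<forall>p. is_path G p \<and> 1 \<le> path_length p \<and> last p \<in> ?B \<longrightarrow>
     (\<exists>q. is_path G q \<and> hd q = hd p \<and> 1 \<le> path_length q \<and> path_length q \<le> path_length p \<and>
     set q \<subseteq> set p \<and> last q \<in> ?B \<and> inner_verts q \<inter> ?B = {} \<and> last q \<noteq> hd q)"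
    using is_path_truncate by blast
  then obtain t where t: "\<And>p. is_path G p \<and> 1 \<le> path_length p \<and> last p \<in> ?B \<Longrightarrow>
     is_path G (t p) \<and> hd (t p) = hd p \<and> 1 \<le> path_length (t p) \<and> path_length (t p) \<le> path_length p \<and>
     set (t p) \<subseteq> set p \<and> last (t p) \<in> ?B \<and> inner_verts (t p) \<inter> ?B = {} \<and> last (t p) \<noteq> hd (t p)"
    by metis
  have tF: "is_path G (t p)" "hd (t p) = v" "path_length (t p) \<le> r" "set (t p) \<subseteq> set p"
      "last (t p) \<in> ?B" "inner_verts (t p) \<inter> ?B = {}" "last (t p) \<noteq> v" "last (t p) \<in> set (t p)"
    if "v \<in> S" "p \<in> F v" for v p
  proof -
    have "is_path G p \<and> 1 \<le> path_length p \<and> last p \<in> ?B" "hd p = v" "path_length p \<le> r"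
      using F(1)[OF that(1)] that(2) unfolding fan_def by auto
    with t[of p] show "is_path G (t p)" "hd (t p) = v" "path_length (t p) \<le> r" "set (t p) \<subseteq> set p"
      "last (t p) \<in> ?B" "inner_verts (t p) \<inter> ?B = {}" "last (t p) \<noteq> v" "last (t p) \<in> set (t p)"
      by (auto simp: is_path_def)
  qed
  have same: "set (t p) \<inter> set (t q) \<subseteq> {v}" if "v \<in> S" "p \<in> F v" "q \<in> F v" "p \<noteq> q" for v p q
    using F(1)[OF that(1)] tF(4)[OF that(1,2)] tF(4)[OF that(1,3)] that(2-4)
    unfolding fan_def by blast
  \<comment> \<open>Equal cut paths would share an end different from \<open>v\<close>, so cutting
    merges no paths of a fan.\<close>
  have inj: "inj_on t (F v)" if "v \<in> S" for v
    by (rule inj_onI) (use same tF(7,8) that in fastforce)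
  have r2: "r \<le> ?s + 1"
    using r by linarith
  define Q' where "Q' = (\<Union>v\<in>R. t ` F v)"
  have diff: "{hd p, last p} \<noteq> {hd q, last q} \<and> inner_verts p \<inter> inner_verts q = {}"
    if pq: "u \<in> R" "v \<in> R" "p \<in> t ` F u" "q \<in> t ` F v" "p \<noteq> q" for u v p q
  proof (cases "u = v")
    case True
    obtain p' q' where e: "p = t p'" "q = t q'" "p' \<in> F v" "q' \<in> F v" "p' \<noteq> q'"
      using pq True by blast
    have v: "v \<in> S"
      using pq R(1) by blast
    have sub: "set p \<inter> set q \<subseteq> {v}"
      using same[OF v e(3-5)] e(1,2) by simp
    have "hd p = v" "hd q = v" "last p \<noteq> v" "last p \<in> set p" "last q \<in> set q"
      using tF[OF v e(3)] tF[OF v e(4)] e(1,2) by auto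
    then show ?thesis
      using sub unfolding inner_verts_def by (auto simp: doubleton_eq_iff)
  next
    case False
    have uS: "u \<in> S" and vS: "v \<in> S"
      using pq R(1) by auto
    obtain p' q' where e: "p = t p'" "q = t q'" "p' \<in> F u" "q' \<in> F v"
      using pq by blast
    note p = tF[OF uS e(3), folded e(1)] and q = tF[OF vS e(4), folded e(2)]
    \<comment> \<open>otherwise \<open>p\<close> itself joins two vertices of the independent set \<open>R\<close>\<close>
    have "last p \<noteq> v"
      using noR[of p] p q pq(1,2) r2 False by auto
    then have ne: "{hd p, last p} \<noteq> {hd q, last q}"
      using p q False by (auto simp: doubleton_eq_iff)
    \<comment> \<open>A common inner vertex would yield a path from \<open>u\<close> to
      \<open>v\<close> of length at most \<open>2 * r - 2\<close> with interior outside
      \<open>S \<union> M\<close>, contradicting the independence of \<open>R\<close>.\<close>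
    have "inner_verts p \<inter> inner_verts q = {}"
    proof (rule ccontr)
      assume "\<not> ?thesis"
      then obtain x where x: "x \<in> inner_verts p" "x \<in> inner_verts q"
        by blast
      have "hd p \<notin> inner_verts q" "hd q \<notin> inner_verts p" "hd p \<noteq> hd q"
        using p(2,6) q(2,6) uS vS False by auto
      then obtain w where w: "is_path G w" "hd w = u" "last w = v"
          "path_length w + 2 \<le> path_length p + path_length q"
          "inner_verts w \<subseteq> inner_verts p \<union> inner_verts q"
        using is_path_join[OF p(1) q(1) x] p(2) q(2) by blast
      have "path_length w \<le> ?s + 1"
        using w(4) p(3) q(3) by linarith
      then show False
        using noR[of w] w p(6) q(6) pq(1,2) False by blast
    qed
    with ne show ?thesis ..
  qed
  have "path_system G ?s ?B Q'"
    unfolding path_system_def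
  proof (intro conjI ballI impI)
    fix p assume "p \<in> Q'"
    then obtain v p' where e: "v \<in> R" "v \<in> S" "p' \<in> F v" "p = t p'"
      using R(1) unfolding Q'_def by blast
    note p = tF[OF e(2,3), folded e(4)]
    show "is_path G p" "hd p \<in> ?B" "last p \<in> ?B" "hd p \<noteq> last p" "path_length p \<le> ?s + 1"
        "inner_verts p \<inter> ?B = {}"
      using p e(2) r2 by auto
  next
    fix p q assume "p \<in> Q'" "q \<in> Q'" "p \<noteq> q"
    then show "{hd p, last p} \<noteq> {hd q, last q}" "inner_verts p \<inter> inner_verts q = {}"
      using diff unfolding Q'_def by blast+
  qed
  moreover have "?B \<subseteq> verts G"
    using S(1) MV by blast
  ultimately have "real (card Q') \<le> d * card ?B"
    unfolding d_def using card_path_system_le[OF G] by blast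
  also have "\<dots> \<le> d * real (card S + card M)"
    using d0 card_Un_le[of S M] by (intro mult_left_mono of_nat_mono)
  finally have up: "real (card Q') \<le> d * real (card S + card M)" .
  have fR: "finite R"
    using R(1) fS finite_subset by blast
  \<comment> \<open>Paths from different fans start at different vertices, so none is counted
    twice.\<close>
  have "card Q' = (\<Sum>v\<in>R. card (t ` F v))"
    unfolding Q'_def
  proof (rule card_UN_disjoint[OF fR]; intro ballI impI)
    fix v assume "v \<in> R"
    then show "finite (t ` F v)"
      using finite_fan[OF G F(1)] R(1) by blast
  next
    fix u v assume uv: "u \<in> R" "v \<in> R" "u \<noteq> v"
    have "hd p = u" if "p \<in> t ` F u" for p
      using tF(2)[of u] uv(1) R(1) that by blast
    moreover have "hd p = v" if "p \<in> t ` F v" for p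
      using tF(2)[of v] uv(2) R(1) that by blast
    ultimately show "t ` F u \<inter> t ` F v = {}"
      using uv(3) by blast
  qed
  moreover have "l \<le> card (t ` F v)" if "v \<in> R" for v
    using F(2)[of v] card_image[OF inj[of v]] R(1) that by auto
  then have "(\<Sum>v\<in>R. l) \<le> (\<Sum>v\<in>R. card (t ` F v))"
    by (rule sum_mono)
  ultimately have "card R * l \<le> card Q'"
    by simp
  then have "real (card R) * real l \<le> real (card Q')"
    unfolding of_nat_mult[symmetric] by (rule of_nat_mono)
  also note up
  also have "d * real (card S + card M) \<le> d * (real (card S) * (1 + real ?s * d))"
    using cardM d0 by (intro mult_left_mono) (simp_all add: algebra_simps)
  also have "\<dots> \<le> d * (real ((?k + 1) * card R) * (1 + real ?s * d))"
    using of_nat_mono[OF R(2), where ?'a = real] d0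
    by (intro mult_left_mono mult_right_mono add_nonneg_nonneg mult_nonneg_nonneg) simp_all
  also have "\<dots> = real (card R) * (d * (real ?k + 1) * (1 + 2 * real (r - 1) * d))"
    unfolding of_nat_mult of_nat_add by simp
  finally have le: "real (card R) * real l
      \<le> real (card R) * (d * (real ?k + 1) * (1 + 2 * real (r - 1) * d))" .
  \<comment> \<open>Since \<open>card S\<close> is at most a multiple of \<open>card R\<close>, the
    set \<open>R\<close> is nonempty and its size can be cancelled.\<close>
  have "card S > 0"
    using S(2) fS by (simp add: card_gt_0_iff)
  then have "0 < real (card R)"
    using R(2) by (cases "card R") simp_all
  with le show ?thesis
    using mult_le_cancel_left_pos by blast
qed

section \<open>Small densities\<close>

lemma top_grad_ge_half:
  assumes G: "simple_graph G" and "edges G \<noteq> {}"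
  shows "1 / 2 \<le> top_grad s G"
proof -
  obtain e where e: "e \<in> edges G"
    using assms by blast
  then obtain a b where ab: "e = {a, b}" "a \<noteq> b" "{a, b} \<subseteq> verts G"
    using G unfolding simple_graph_def by (metis card_2_iff)
  have "path_system G (2 * s) {a, b} {[a, b]}"
    using e ab by (auto simp: path_system_def is_path_iff path_length_def inner_verts_def)
  from card_path_system_le[OF G ab(3) this] show ?thesis
    using ab(2) by simp
qed

text \<open>Two edges sharing a vertex are a system of two paths on three vertices.\<close>

lemma top_grad_ge_two_thirds:
  assumes G: "simple_graph G" and "\<not> pairwise disjnt (edges G)"
  shows "2 / 3 \<le> top_grad s G"
proof -
  obtain e f x where ef: "e \<in> edges G" "f \<in> edges G" "e \<noteq> f" "x \<in> e" "x \<in> f"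
    using assms unfolding pairwise_def disjnt_def by blast
  have other: "\<exists>a. g = {x, a} \<and> x \<noteq> a" if "g \<in> edges G" "x \<in> g" for g
    using G that unfolding simple_graph_def by (metis card_2_iff doubleton_eq_iff empty_iff insert_iff)
  obtain a b where ab: "e = {x, a}" "x \<noteq> a" "f = {x, b}" "x \<noteq> b"
    using other ef by metis
  have V: "{x, a, b} \<subseteq> verts G"
    using G ef ab unfolding simple_graph_def by blast
  have "a \<noteq> b"
    using ef ab by auto
  then have "path_system G (2 * s) {x, a, b} {[x, a], [x, b]}"
    using ef ab V
    by (auto simp: path_system_def is_path_iff path_length_def inner_verts_def doubleton_eq_iff)
  from card_path_system_le[OF G V this] show ?thesis
    using ab \<open>a \<noteq> b\<close> by simp
qed

section \<open>Matchings and the final arithmetic\<close>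

text \<open>The first edges of all paths in a fan contain \<open>v\<close>, so in a matching they
  coincide; two different paths would then share a second vertex.\<close>

lemma fan_card_le_one_of_matching:
  assumes G: "simple_graph G" and m: "pairwise disjnt (edges G)" and F: "fan G r S v F"
  shows "card F \<le> 1" "edges G = {} \<Longrightarrow> card F = 0"
proof -
  have second: "\<exists>a. a \<in> set p \<and> a \<noteq> v \<and> {v, a} \<in> edges G" if "p \<in> F" for p
  proof -
    have p: "is_path G p" "1 \<le> path_length p" "hd p = v"
      using F that unfolding fan_def by auto
    then obtain a ys where "p = v # a # ys"
      unfolding path_length_def by (cases p; cases "tl p") auto
    then show ?thesis
      using p(1) unfolding is_path_iff by auto
  qed
  have "p = q" if pq: "p \<in> F" "q \<in> F" for p q
  proof (rule ccontr)
    assume ne: "p \<noteq> q"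
    obtain a b where ab: "a \<in> set p" "a \<noteq> v" "{v, a} \<in> edges G" "b \<in> set q" "{v, b} \<in> edges G"
      using second[OF pq(1)] second[OF pq(2)] by blast
    have "{v, a} = {v, b}"
      using m ab unfolding pairwise_def disjnt_def by (metis disjoint_iff insertI1)
    then have "a \<in> set p \<inter> set q"
      using ab by (auto simp: doubleton_eq_iff)
    then show False
      using F pq ne ab(2) unfolding fan_def by blast
  qed
  then show "card F \<le> 1"
    using card_le_Suc0_iff_eq[OF finite_fan[OF G F]] by simp
  show "card F = 0" if "edges G = {}"
    using second that by (metis card_eq_0_iff empty_iff equals0I)
qed

text \<open>With \<open>2 * d\<close> in place of its floor, the inequality fails for \<open>r = 2\<close> and \<open>d = 2 / 3\<close>.\<close>

lemma density_bound:
  fixes d :: real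
  assumes r: "1 \<le> r" and d: "2 / 3 \<le> d"
  shows "d * (real (nat \<lfloor>2 * d\<rfloor>) + 1) * (1 + 2 * real (r - 1) * d) \<le> 6 * real r * d ^ 3"
proof -
  obtain n where n: "r = Suc n"
    using r by (cases r) auto
  have "(real (nat \<lfloor>2 * d\<rfloor>) + 1) * (1 + 2 * real n * d) \<le> 6 * (real n + 1) * d\<^sup>2"
  proof (cases "d < 1")
    case True
    \<comment> \<open>From \<open>2 / 3 \<le> d < 1\<close> the floor is exactly \<open>1\<close>,
      and the lower bound on \<open>d\<close> is equivalent to
      \<open>2 * d \<le> 3 * d\<^sup>2\<close>.\<close>
    then have "nat \<lfloor>2 * d\<rfloor> = 1"
      using d by linarith
    moreover have "3 * d\<^sup>2 \<ge> 2 * d"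
      using d by (simp add: power2_eq_square)
    moreover from this have "real n * (3 * d\<^sup>2) \<ge> real n * (2 * d)"
      by (intro mult_left_mono) auto
    moreover have "3 * d\<^sup>2 \<ge> 1"
      using \<open>3 * d\<^sup>2 \<ge> 2 * d\<close> d by linarith
    ultimately show ?thesis
      by (simp add: algebra_simps)
  next
    case False
    \<comment> \<open>For \<open>d \<ge> 1\<close> the crude estimate
      \<open>2 * d + 1 \<le> 3 * d\<close> suffices.\<close>
    then have "real (nat \<lfloor>2 * d\<rfloor>) + 1 \<le> 3 * d"
      by linarith
    moreover have "1 + 2 * real n * d \<le> 2 * (real n + 1) * d"
      using False by (simp add: algebra_simps)
    ultimately have "(real (nat \<lfloor>2 * d\<rfloor>) + 1) * (1 + 2 * real n * d) \<le> (3 * d) * (2 * (real n + 1) * d)"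
      using False by (intro mult_mono) auto
    then show ?thesis
      by (simp add: power2_eq_square algebra_simps)
  qed
  then have "d * ((real (nat \<lfloor>2 * d\<rfloor>) + 1) * (1 + 2 * real n * d)) \<le> d * (6 * (real n + 1) * d\<^sup>2)"
    using d by (intro mult_left_mono) auto
  then show ?thesis
    by (simp add: n power3_eq_cube power2_eq_square algebra_simps)
qed

(* The last assumption removes the only case in which the inequality fails: a graph with at
   least one edge and no two edges sharing a vertex has 1-admissibility 1 but
   6 * top_grad 0 G ^ 3 = 3 / 4. *)

theorem theorem1:
  fixes G :: "'a graph" and r :: nat
  assumes "simple_graph G"
    and "1 \<le> r"
    and "\<not> (r = 1 \<and> edges G \<noteq> {} \<and> pairwise disjnt (edges G))"
  shows "real (adm r G) \<le> 6 * real r * top_grad (r - 1) G ^ 3"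
proof -
  let ?d = "top_grad (r - 1) G"
  note G = assms(1)
  show ?thesis
  proof (cases "pairwise disjnt (edges G)")
    case matching: True
    show ?thesis
    proof (cases "edges G = {}")
      case True
      then have "adm r G \<le> 0"
        using fan_card_le_one_of_matching(2)[OF G matching] by (intro adm_le[OF G]) (metis ex_in_conv order_refl)
      then show ?thesis
        using top_grad_nonneg[OF G] by simp
    next
      case False
      then have "2 \<le> r"
        using assms matching by auto
      have "(1 / 2) ^ 3 \<le> ?d ^ 3"
        using top_grad_ge_half[OF G False] by (intro power_mono) auto
      \<comment> \<open>For \<open>r \<ge> 2\<close> the right side is at least
        \<open>3 / 2\<close>, while the admissibility is at most \<open>1\<close>.\<close>
      then have "12 * (1 / 2) ^ 3 \<le> 6 * real r * ?d ^ 3"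
        using \<open>2 \<le> r\<close> by (intro mult_mono) auto
      moreover have "adm r G \<le> 1"
        using fan_card_le_one_of_matching(1)[OF G matching] by (intro adm_le[OF G]) (metis ex_in_conv)
      ultimately show ?thesis
        by (simp add: power3_eq_cube)
    qed
  next
    case False
    \<comment> \<open>Fan sizes are integers: if the floor fails as a bound at every vertex of some
      \<open>S\<close>, all of them have fans of size \<open>Suc ?K\<close>, which exceeds the real
      bound.\<close>
    let ?K = "nat \<lfloor>6 * real r * ?d ^ 3\<rfloor>"
    have "\<exists>v\<in>S. \<forall>F. fan G r S v F \<longrightarrow> card F \<le> ?K" if S: "S \<subseteq> verts G" "S \<noteq> {}" for S
    proof (rule ccontr)
      assume "\<not> ?thesis"
      then have "\<exists>F. fan G r S v F \<and> Suc ?K \<le> card F" if "v \<in> S" for v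
        using that by (metis not_less_eq_eq)
      from card_le_of_fans[OF G assms(2) S this]
      have "real (Suc ?K) \<le> 6 * real r * ?d ^ 3"
        using density_bound[OF assms(2) top_grad_ge_two_thirds[OF G False, of "r - 1"]] by linarith
      then show False
        by linarith
    qed
    then have "adm r G \<le> ?K"
      by (rule adm_le[OF G])
    moreover have "0 \<le> 6 * real r * ?d ^ 3"
      using top_grad_nonneg[OF G] by simp
    ultimately show ?thesis
      by linarith
  qed
qed

end
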